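(* Let $\tau\in\mathbb{C}$ with $\operatorname{Im}\tau>0$, $q=e^{2\pi i\tau}$, and let $n$ be a positive integer. Then $$(q;q)_\infty^{2n}=q^{-n}\,(q^{2n};q^{2n})_\infty\sum_{\substack{s_1,s_2,\dots,s_{2n}=-\infty\\ s_1+s_2+\cdots+s_{2n}=2n}}^{\infty}q^{\frac12(s_1^2+s_2^2+\cdots+s_{2n}^2)}\,e^{\frac{\pi i}{2n}\sum_{l=1}^{n}(s_l-s_{n+l})(2l-1)},$$ the sum being over all integers $s_1,\dots,s_{2n}$ with the indicated sum.
   Context: For real $a$, $q^a:=e^{2\pi i a\tau}$. The $q$-shifted factorial is $(z;q)_\infty=\prod_{k=0}^{\infty}(1-zq^k)$ for $|q|<1$, and $(q;q)_\infty^{2n}$ denotes its $2n$-th power $((q;q)_\infty)^{2n}$. *)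

theory Defs
  imports "HOL-Analysis.Analysis"
begin

(* q^a for q = e^(2 pi i tau) and real a; it depends on tau, not only on q
   (powr would use the principal logarithm of q instead). *)
definition qpow :: "complex \<Rightarrow> real \<Rightarrow> complex" where
  "qpow \<tau> a = exp (2 * complex_of_real pi * \<i> * complex_of_real a * \<tau>)"

(* (z;q)_infinity; meaningful for norm q < 1. *)
definition qpochhammer_inf :: "complex \<Rightarrow> complex \<Rightarrow> complex" where
  "qpochhammer_inf z q = (\<Prod>k. 1 - z * q ^ k)"

(* A tuple (s_1, ..., s_m) of integers is a function on {1..m}, undefined elsewhere,
   so that distinct functions in the set are distinct tuples. *)
definition int_tuples_with_sum :: "nat \<Rightarrow> int \<Rightarrow> (nat \<Rightarrow> int) set" where
  "int_tuples_with_sum m N = {s \<in> {1..m} \<rightarrow>\<^sub>E UNIV. (\<Sum>i=1..m. s i) = N}"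

end

theory Submission
  imports Defs
begin

text \<open>
  Write \<open>p = e^(\<pi> i \<tau>)\<close>, so that \<open>q = p\<^sup>2\<close>, and let \<open>\<theta>(x) = \<Sum> p^(s\<^sup>2) x^s\<close>, the sum being over all
  integers \<open>s\<close>. The exponential in the multiple sum is a product \<open>\<Prod> \<omega>\<^sub>i^(s\<^sub>i)\<close> in which
  \<open>\<omega>\<^sub>1, \<dots>, \<omega>\<^sub>2\<^sub>n\<close> are the \<open>2n\<close>-th roots of \<open>-1\<close>. Hence the multiple sum is the coefficient of \<open>z^(2n)\<close>
  in the product of the \<open>2n\<close> series \<open>\<theta>(z \<omega>\<^sub>i)\<close> (\<open>has_sum_tuples_by_sum\<close>).

  By the Jacobi triple product (\<open>Jacobi_triple_product\<close>)
  \<open>\<theta>(x) = (q;q)\<^sub>\<infinity> \<Prod> (1 + x p q^k)(1 + x^(-1) p q^k)\<close>. Because \<open>\<Prod> (1 + y \<omega>\<^sub>i) = 1 + y^(2n)\<close>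
  (\<open>prod_one_plus_eq_one_plus_power\<close>), the product of the \<open>\<theta>(z \<omega>\<^sub>i)\<close> collapses factor by factor to
  \<open>(q;q)\<^sub>\<infinity>^(2n)\<close> times the two factors that occur in the triple product with \<open>p\<close> and \<open>x\<close> replaced by
  \<open>p^(2n)\<close> and \<open>z^(2n)\<close>. So it equals
  \<open>(q;q)\<^sub>\<infinity>^(2n) / (q^(2n);q^(2n))\<^sub>\<infinity> \<sqdot> \<Sum> (p^(2n))^(j\<^sup>2) z^(2n j)\<close>, whose coefficient of \<open>z^(2n)\<close> is
  the quotient times \<open>p^(2n) = q^n\<close>. Laurent coefficients on the unit circle are unique
  (\<open>circle_coefficients_unique\<close>), and equating the two expressions for the coefficient gives the
  result (\<open>theta_product_coefficient\<close>).

  The triple product itself is the limit, by dominated convergence, of its finite form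
  (\<open>finite_triple_product\<close>), which follows by induction from a recurrence for q-binomial
  coefficients.
\<close>

section \<open>Dominated convergence for unordered sums\<close>

text \<open>
  A limit and an unordered sum commute under a summable majorant, because the partial sums over
  finite sets then converge uniformly in the parameter. This is used twice: to pass from the finite
  to the infinite triple product, and to isolate one Laurent coefficient by a sieve modulo a growing
  modulus.
\<close>

lemma tendsto_has_sum_dominated:
  fixes f :: "'i \<Rightarrow> 'b \<Rightarrow> 'c :: banach"
  assumes limit: "\<And>i. i \<in> I \<Longrightarrow> ((\<lambda>y. f i y) \<longlongrightarrow> g i) F"
    and bound: "\<And>i y. i \<in> I \<Longrightarrow> norm (f i y) \<le> M i"
    and M: "M summable_on I"
    and sums: "\<And>y. ((\<lambda>i. f i y) has_sum S y) I"
    and "(S \<longlongrightarrow> L) F" and F: "F \<noteq> bot"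
  shows "(g has_sum L) I"
proof -
  have g_bound: "norm (g i) \<le> M i" if "i \<in> I" for i
    by (rule tendsto_upperbound[OF tendsto_norm[OF limit[OF that]]]) (use bound that F in auto)
  have "(\<lambda>i. norm (g i)) summable_on I"
    by (rule Infinite_Sum.abs_summable_on_comparison_test'[OF M g_bound])
  then have g: "(g has_sum infsum g I) I"
    by (blast intro: has_sum_infsum dest: abs_summable_summable)
  have "(S \<longlongrightarrow> infsum g I) F"
  proof (rule swap_uniform_limit')
    show "((\<lambda>X. \<Sum>i\<in>X. g i) \<longlongrightarrow> infsum g I) (finite_subsets_at_top I)"
      using g by (simp add: has_sum_def)
    show "\<forall>\<^sub>F X in finite_subsets_at_top I. ((\<lambda>y. \<Sum>i\<in>X. f i y) \<longlongrightarrow> (\<Sum>i\<in>X. g i)) F"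
    proof (rule eventually_finite_subsets_at_top_weakI)
      show "((\<lambda>y. \<Sum>i\<in>X. f i y) \<longlongrightarrow> (\<Sum>i\<in>X. g i)) F" if "X \<subseteq> I" for X
        by (intro tendsto_sum limit) (use that in auto)
    qed
    show "uniform_limit UNIV (\<lambda>X y. \<Sum>i\<in>X. f i y) S (finite_subsets_at_top I)"
      by (rule Weierstrass_m_test_general'[OF bound sums M]) auto
  qed auto
  with g \<open>(S \<longlongrightarrow> L) F\<close> F show ?thesis
    using tendsto_unique by blast
qed

section \<open>The infinite q-shifted factorial\<close>


lemma qpochhammer_convergent:
  fixes z q :: complex
  assumes "norm q < 1"
  shows "convergent_prod (\<lambda>k. 1 - z * q ^ k)"
proof -
  have "summable (\<lambda>k. norm ((1 - z * q ^ k) - 1))"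
    using assms by (simp add: norm_mult norm_power summable_mult summable_geometric)
  then show ?thesis
    by (intro abs_convergent_prod_imp_convergent_prod)
       (simp add: abs_convergent_prod_conv_summable)
qed

lemma qpochhammer_tendsto:
  assumes "norm q < 1"
  shows "(\<lambda>N. \<Prod>k<N. 1 - z * q ^ k) \<longlonglongrightarrow> qpochhammer_inf z q"
  unfolding qpochhammer_inf_def
  by (intro has_prod_imp_tendsto' convergent_prod_has_prod qpochhammer_convergent assms)

lemma euler_factor_nonzero:
  fixes q :: complex
  assumes "norm q < 1"
  shows "1 - q * q ^ k \<noteq> 0"
proof
  assume "1 - q * q ^ k = 0"
  then have "norm q ^ Suc k = 1"
    by (metis eq_iff_diff_eq_0 norm_one norm_power power_Suc)
  then show False
    using assms power_Suc_less_one[of "norm q" k] power_strict_mono[of "norm q" 1 "Suc k"] by simp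
qed

lemma qpochhammer_self_nonzero:
  assumes "norm q < 1"
  shows "qpochhammer_inf q q \<noteq> 0"
  unfolding qpochhammer_inf_def
  by (intro prodinf_nonzero qpochhammer_convergent euler_factor_nonzero assms)

text \<open>
  If the \<open>\<omega>\<^sub>j\<close> are the numbers with \<open>\<Prod>(1 + y \<omega>\<^sub>j) = 1 + y^m\<close>, then multiplying theta factors over
  all twists \<open>x \<omega>\<^sub>j\<close> produces a single factor of the same kind with \<open>x\<close> and \<open>q\<close> replaced by their
  \<open>m\<close>-th powers: the identity applies to each factor of the infinite product separately.
\<close>

lemma prod_qpochhammer:
  assumes q: "norm q < 1"
    and factor: "\<And>y. (\<Prod>j\<in>A. 1 + y * \<omega> j) = 1 + y ^ m"
  shows "(\<Prod>j\<in>A. qpochhammer_inf (- (x * \<omega> j)) q) = qpochhammer_inf (- (x ^ m)) (q ^ m)"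
proof -
  have "(\<Prod>j\<in>A. qpochhammer_inf (- (x * \<omega> j)) q) = (\<Prod>k. \<Prod>j\<in>A. 1 - (- (x * \<omega> j)) * q ^ k)"
    unfolding qpochhammer_inf_def
    by (rule prodinf_prod[symmetric]) (rule qpochhammer_convergent[OF q])
  also have "(\<Prod>j\<in>A. 1 - (- (x * \<omega> j)) * q ^ k) = 1 - (- (x ^ m)) * (q ^ m) ^ k" for k
    using factor[of "x * q ^ k"]
    by (simp add: mult_ac power_mult_distrib power_mult[symmetric])
  then have "(\<Prod>k. \<Prod>j\<in>A. 1 - (- (x * \<omega> j)) * q ^ k) = qpochhammer_inf (- (x ^ m)) (q ^ m)"
    unfolding qpochhammer_inf_def by simp
  finally show ?thesis .
qed

section \<open>The Jacobi triple product\<close>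

text \<open>
  The reciprocal \<open>1/(q;q)\<^sub>a\<close>. The value 0 at negative \<open>a\<close>, natural because the recursion
  \<open>1/(q;q)\<^sub>a = (1 - q^(a+1)) \<sqdot> 1/(q;q)\<^sub>a\<^sub>+\<^sub>1\<close> forces it at \<open>a = -1\<close>, makes q-binomial coefficients vanish
  outside their range, so that finite sums can be written as sums over all integers.
\<close>

definition qpoch_recip :: "complex \<Rightarrow> int \<Rightarrow> complex" where
  "qpoch_recip q a = (if a < 0 then 0 else inverse (\<Prod>k<nat a. 1 - q * q ^ k))"

lemma qpoch_recip_step:
  assumes "norm q < 1"
  shows "qpoch_recip q a = (1 - q ^ nat (a + 1)) * qpoch_recip q (a + 1)"
proof (cases "a < 0")
  case True
  then show ?thesis by (cases "a = -1") (auto simp: qpoch_recip_def)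
next
  case False
  then have "nat (a + 1) = Suc (nat a)" by simp
  then show ?thesis
    using False euler_factor_nonzero[OF assms, of "nat a"] by (simp add: qpoch_recip_def)
qed

text \<open>
  The coefficient \<open>c N j\<close> is the q-binomial coefficient \<open>[2N choose N+j]\<close>. Passing from \<open>N\<close> to
  \<open>N + 1\<close> multiplies the product by
  \<open>(1 + x p q^N)(1 + p q^N / x) = 1 + q^(2N+1) + x p q^N + p q^N / x\<close>, so a new coefficient is a
  combination of three neighbouring old ones. Since the sums run over all integers, the two shifts
  are mere reindexings, and only a three-term recurrence for q-binomial coefficients remains.
\<close>

lemma finite_triple_product:
  fixes p x :: complex
  assumes p: "norm p < 1" and x: "x \<noteq> 0"
  defines "q \<equiv> p ^ 2"
  defines "c \<equiv> (\<lambda>N j. (\<Prod>k<2 * N. 1 - q * q ^ k) * qpoch_recip q (int N - j) * qpoch_recip q (int N + j))"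
  shows "((\<lambda>j::int. c N j * p ^ nat (j ^ 2) * x powi j) has_sum
     (\<Prod>k<N. (1 + x * p * q ^ k) * (1 + p / x * q ^ k))) UNIV"
proof (induction N)
  case 0
  have "((\<lambda>j::int. c 0 j * p ^ nat (j ^ 2) * x powi j) has_sum 1) UNIV"
    by (rule has_sum_finite_neutralI[where B = "{0}"]) (auto simp: c_def qpoch_recip_def)
  then show ?case by simp
next
  case (Suc N)
  have q: "norm q < 1"
    using p by (simp add: q_def norm_power power_less_one_iff)
  define t where "t = (\<lambda>N (j::int). c N j * p ^ nat (j ^ 2) * x powi j)"
  have bij: "bij_betw (\<lambda>j::int. j + d) UNIV UNIV" for d
    by (rule bij_betwI[where g = "\<lambda>j. j - d"]) auto
  let ?G = "\<Prod>k<N. (1 + x * p * q ^ k) * (1 + p / x * q ^ k)"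
  have t0: "(t N has_sum ?G) UNIV"
    using Suc by (simp add: t_def)
  have t1: "((\<lambda>j. t N (j + d)) has_sum ?G) UNIV" for d
    using t0 has_sum_reindex_bij_betw[OF bij, of "t N" d ?G] by simp
  have step: "t (Suc N) j = (1 + q ^ (2 * N + 1)) * t N j
      + (x * p * q ^ N) * t N (j + (-1)) + (p / x * q ^ N) * t N (j + 1)" for j
  proof (cases "\<bar>j\<bar> \<le> int N + 1")
    case False
    then show ?thesis
      by (auto simp: t_def c_def qpoch_recip_def)
  next
    case True
    define a b where "a = int N - j" and "b = int N + j"
    define Q where "Q = (\<Prod>k<2 * N. 1 - q * q ^ k)"
    define R where "R = qpoch_recip q"
    have R: "R i = (1 - q ^ nat (i + 1)) * R (i + 1)" for i
      unfolding R_def by (rule qpoch_recip_step[OF q])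
    have Ra: "R a = (1 - q ^ nat (a + 1)) * R (a + 1)"
      and Rb: "R b = (1 - q ^ nat (b + 1)) * R (b + 1)" by (rule R)+
    have Ra': "R (a - 1) = (1 - q ^ nat a) * R a" and Rb': "R (b - 1) = (1 - q ^ nat b) * R b"
      using R[of "a - 1"] R[of "b - 1"] by simp_all
    have cSuc: "c (Suc N) j = Q * (1 - q ^ (2 * N + 1)) * (1 - q ^ (2 * N + 2)) * R (a + 1) * R (b + 1)"
      by (simp add: c_def Q_def R_def a_def b_def algebra_simps)
    have c0: "c N j = Q * R a * R b"
      by (simp add: c_def Q_def R_def a_def b_def)
    have cm: "c N (j - 1) = Q * R (a + 1) * R (b - 1)" 
      by (simp add: c_def Q_def R_def a_def b_def algebra_simps)
    have cp: "c N (j + 1) = Q * R (a - 1) * R (b + 1)"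
      by (simp add: c_def Q_def R_def a_def b_def algebra_simps)
    \<comment> \<open>The recurrence after division by the common power of \<open>p\<close>. Inside the range it is a polynomial
        identity in \<open>q^a\<close> and \<open>q^b\<close>; at the ends \<open>j = \<plusminus>(N + 1)\<close> only one neighbour survives.\<close>
    have key: "c (Suc N) j = (1 + q ^ (2 * N + 1)) * c N j + q ^ nat (a + 1) * c N (j - 1)
        + q ^ nat (b + 1) * c N (j + 1)"
    proof (cases "a < 0 \<or> b < 0")
      case False
      then obtain u v where uv: "a = int u" "b = int v"
        by (metis nonneg_int_cases not_less)
      have uvN: "2 * N = u + v" using uv by (simp add: a_def b_def)
      have nats: "nat (a + 1) = u + 1" "nat (b + 1) = v + 1" "nat a = u" "nat b = v"
        using uv by auto
      show ?thesis
        unfolding cSuc c0 cm cp Ra' Rb' Ra Rb uvN nats power_add power_one_right power2_eq_square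
        by algebra
    next
      case True
      then consider "a = -1" "b = 2 * int N + 1" | "b = -1" "a = 2 * int N + 1" 
        using \<open>\<bar>j\<bar> \<le> int N + 1\<close> unfolding a_def b_def by linarith
      then show ?thesis
      proof cases
        case 1
        then have "nat (a + 1) = 0" "nat (b + 1) = 2 * N + 2" "nat b = 2 * N + 1" "nat a = 0" by auto
        then show ?thesis
          unfolding cSuc c0 cm cp Ra' Rb' Ra Rb by (simp add: algebra_simps)
      next
        case 2
        then have "nat (b + 1) = 0" "nat (a + 1) = 2 * N + 2" "nat a = 2 * N + 1" "nat b = 0" by auto
        then show ?thesis
          unfolding cSuc c0 cm cp Ra' Rb' Ra Rb by (simp add: algebra_simps)
      qed
    qed
    \<comment> \<open>Completing the square: this converts the powers of \<open>q\<close> in the recurrence into the quadratic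
        exponents of the neighbouring terms.\<close>
    have e: "nat (j ^ 2) + 2 * nat (a + 1) = 2 * N + 1 + nat ((j - 1) ^ 2)"
      "nat (j ^ 2) + 2 * nat (b + 1) = 2 * N + 1 + nat ((j + 1) ^ 2)"
    proof -
      have "0 \<le> a + 1" "0 \<le> b + 1"
        using True by (auto simp: a_def b_def)
      then have "int (nat (j ^ 2) + 2 * nat (a + 1)) = int (2 * N + 1 + nat ((j - 1) ^ 2))"
        and "int (nat (j ^ 2) + 2 * nat (b + 1)) = int (2 * N + 1 + nat ((j + 1) ^ 2))"
        unfolding of_nat_add of_nat_mult
        by (simp_all add: nat_0_le del: int_nat_eq) (simp_all add: a_def b_def power2_eq_square algebra_simps)
      then show "nat (j ^ 2) + 2 * nat (a + 1) = 2 * N + 1 + nat ((j - 1) ^ 2)"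
        and "nat (j ^ 2) + 2 * nat (b + 1) = 2 * N + 1 + nat ((j + 1) ^ 2)"
        by (simp_all only: of_nat_eq_iff)
    qed
    have pm: "p ^ nat (j ^ 2) * q ^ nat (a + 1) = p * q ^ N * p ^ nat ((j - 1) ^ 2)"
      and pp: "p ^ nat (j ^ 2) * q ^ nat (b + 1) = p * q ^ N * p ^ nat ((j + 1) ^ 2)"
      using arg_cong[OF e(1), of "\<lambda>m. p ^ m"] arg_cong[OF e(2), of "\<lambda>m. p ^ m"]
      by (simp_all add: q_def power_add power_mult[symmetric])
    have xm: "x powi j = x * x powi (j - 1)" and xp: "x powi (j + 1) = x * x powi j"
      using x by (simp_all add: power_int_add_1' power_int_diff)
    have "t (Suc N) j = (1 + q ^ (2 * N + 1)) * c N j * p ^ nat (j ^ 2) * x powi j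
        + c N (j - 1) * (p ^ nat (j ^ 2) * q ^ nat (a + 1)) * x powi j
        + c N (j + 1) * (p ^ nat (j ^ 2) * q ^ nat (b + 1)) * x powi j"
      unfolding t_def key by (simp add: algebra_simps)
    also have "\<dots> = (1 + q ^ (2 * N + 1)) * c N j * p ^ nat (j ^ 2) * x powi j
        + c N (j - 1) * (p * q ^ N * p ^ nat ((j - 1) ^ 2)) * (x * x powi (j - 1))
        + c N (j + 1) * (p * q ^ N * p ^ nat ((j + 1) ^ 2)) * (x powi (j + 1) / x)"
      unfolding pm pp xm[symmetric] xp using x by simp
    also have "\<dots> = (1 + q ^ (2 * N + 1)) * t N j
      + (x * p * q ^ N) * t N (j + (-1)) + (p / x * q ^ N) * t N (j + 1)"
      by (simp add: t_def)
    finally show ?thesis .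
  qed
  have "(t (Suc N) has_sum ((1 + q ^ (2 * N + 1)) * ?G + (x * p * q ^ N) * ?G + (p / x * q ^ N) * ?G)) UNIV"
    unfolding step by (intro has_sum_add has_sum_cmult_right t0 t1)
  also have "(1 + q ^ (2 * N + 1)) * ?G + (x * p * q ^ N) * ?G + (p / x * q ^ N) * ?G
      = ?G * ((1 + x * p * q ^ N) * (1 + p / x * q ^ N))"
  proof -
    have "q ^ (2 * N + 1) = p * p * (q ^ N * q ^ N)"
      by (simp add: q_def power2_eq_square power_add mult_2)
    then show ?thesis using x by (simp add: field_simps)
  qed
  finally show ?case by (simp add: t_def)
qed

text \<open>
  On each half line the term is \<open>(r^n u)^n\<close> with \<open>u = s\<close> or \<open>u = 1/s\<close>, and \<open>r^n u\<close> is eventually below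
  \<open>1/2\<close>; so a geometric series dominates.
\<close>

lemma theta_terms_summable:
  fixes r :: real and s :: real
  assumes "0 \<le> r" "r < 1" "0 < s"
  shows "(\<lambda>j::int. r ^ nat (j ^ 2) * s powi j) summable_on UNIV"
proof -
  have nat_summable: "(\<lambda>n. r ^ (n ^ 2) * u ^ n) summable_on UNIV" if "u > 0" for u :: real
  proof -
    have "(\<lambda>n. r ^ n * u) \<longlonglongrightarrow> 0 * u"
      by (intro tendsto_mult LIMSEQ_realpow_zero tendsto_const assms)
    then have "\<forall>\<^sub>F n in sequentially. r ^ n * u < 1 / 2"
      by (intro order_tendstoD) auto
    then have ev: "\<forall>\<^sub>F n in sequentially. norm (r ^ (n ^ 2) * u ^ n) \<le> (1 / 2) ^ n"
    proof eventually_elim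
      case (elim n)
      have "norm (r ^ (n ^ 2) * u ^ n) = (r ^ n * u) ^ n"
        using assms that by (simp add: power_mult_distrib power2_eq_square power_mult)
      also have "\<dots> \<le> (1 / 2) ^ n"
        using elim assms that by (intro power_mono) auto
      finally show ?case .
    qed
    have "summable (\<lambda>n. r ^ (n ^ 2) * u ^ n)"
      by (rule summable_comparison_test_ev[OF ev]) (simp add: summable_geometric)
    then show ?thesis
      using assms that by (intro summable_nonneg_imp_summable_on) auto
  qed
  have "(\<lambda>j::int. r ^ nat (j ^ 2) * s powi j) summable_on (range int)"
    by (subst summable_on_reindex)
       (use nat_summable[of s] assms in \<open>auto simp: o_def nat_power_eq\<close>)
  moreover have "(\<lambda>j::int. r ^ nat (j ^ 2) * s powi j) summable_on (range (\<lambda>n. - int n))"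
    by (subst summable_on_reindex)
       (use nat_summable[of "inverse s"] assms in
         \<open>auto simp: o_def nat_power_eq power_int_minus power_inverse inj_on_def\<close>)
  ultimately have "(\<lambda>j::int. r ^ nat (j ^ 2) * s powi j) summable_on (range int \<union> range (\<lambda>n. - int n))"
    by (rule summable_on_union)
  moreover have "range int \<union> range (\<lambda>n. - int n) = UNIV"
    by (auto intro: int_cases2)
  ultimately show ?thesis by simp
qed

text \<open>
  Let \<open>N\<close> tend to infinity in the finite triple product. Each q-binomial coefficient tends to
  \<open>1/(q;q)\<^sub>\<infinity>\<close>, and all of them are bounded by one constant because \<open>(q;q)\<^sub>N\<close> converges to a nonzero
  limit; hence a multiple of the series of absolute values is a summable majorant.
\<close>

theorem Jacobi_triple_product:
  fixes p x :: complex
  assumes p: "norm p < 1" and x: "x \<noteq> 0"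
  shows "((\<lambda>j::int. p ^ nat (j ^ 2) * x powi j) has_sum
     (qpochhammer_inf (p ^ 2) (p ^ 2) *
      (qpochhammer_inf (- (x * p)) (p ^ 2) * qpochhammer_inf (- (p / x)) (p ^ 2)))) UNIV"
proof -
  define q where "q = p ^ 2"
  have q: "norm q < 1"
    using p by (simp add: q_def norm_power power_less_one_iff)
  define Q where "Q = (\<lambda>N. \<Prod>k<N. 1 - q * q ^ k)"
  define E where "E = qpochhammer_inf q q"
  have Q: "Q \<longlonglongrightarrow> E"
    unfolding Q_def E_def by (rule qpochhammer_tendsto[OF q])
  have E: "E \<noteq> 0"
    unfolding E_def by (rule qpochhammer_self_nonzero[OF q])
  have invQ: "(\<lambda>N. inverse (Q N)) \<longlonglongrightarrow> inverse E"
    by (rule tendsto_inverse[OF Q E])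
  define c where "c = (\<lambda>(j::int) N. Q (2 * N) * qpoch_recip q (int N - j) * qpoch_recip q (int N + j))"
  have recip: "(\<lambda>N. qpoch_recip q (int N + d)) \<longlonglongrightarrow> inverse E" for d
  proof (rule Lim_transform_eventually)
    show "(\<lambda>N. inverse (Q (nat (int N + d)))) \<longlonglongrightarrow> inverse E"
    proof (rule filterlim_compose[OF invQ])
      show "filterlim (\<lambda>N. nat (int N + d)) sequentially sequentially"
        unfolding filterlim_at_top eventually_sequentially
      proof
        show "\<exists>M. \<forall>N\<ge>M. Z \<le> nat (int N + d)" for Z
          by (rule exI[of _ "nat (int Z - d)"]) linarith
      qed
    qed
    show "\<forall>\<^sub>F N in sequentially. inverse (Q (nat (int N + d))) = qpoch_recip q (int N + d)"
      unfolding eventually_sequentially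
      by (intro exI[of _ "nat (- d)"]) (auto simp: qpoch_recip_def Q_def)
  qed
  have c_lim: "c j \<longlonglongrightarrow> inverse E" for j
  proof -
    have "(\<lambda>N. Q (2 * N)) \<longlonglongrightarrow> E"
      by (rule filterlim_compose[OF Q]) (auto intro!: filterlim_subseq strict_monoI)
    then have "c j \<longlonglongrightarrow> E * inverse E * inverse E"
      unfolding c_def using recip[of "- j"] recip[of j] by (intro tendsto_mult) simp_all
    then show ?thesis using E by simp
  qed
  obtain K1 where K1: "\<And>N. norm (Q N) \<le> K1"
    using convergent_imp_Bseq[OF convergentI[OF Q]] by (auto simp: Bseq_def)
  obtain K2 where K2: "\<And>N. norm (inverse (Q N)) \<le> K2"
    using convergent_imp_Bseq[OF convergentI[OF invQ]] by (auto simp: Bseq_def)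
  have K1_pos: "0 \<le> K1" and K2_pos: "0 \<le> K2"
    using K1[of 0] K2[of 0] norm_ge_zero order_trans by blast+
  have recip_bound: "norm (qpoch_recip q a) \<le> K2" for a
    using K2[of "nat a"] K2_pos by (auto simp: qpoch_recip_def Q_def)
  have c_bound: "norm (c j N) \<le> K1 * K2 * K2" for j N
    unfolding c_def norm_mult
    by (intro mult_mono K1 recip_bound mult_nonneg_nonneg norm_ge_zero K1_pos K2_pos)
  have "((\<lambda>j::int. inverse E * p ^ nat (j ^ 2) * x powi j) has_sum
     (qpochhammer_inf (- (x * p)) q * qpochhammer_inf (- (p / x)) q)) UNIV"
  proof (rule tendsto_has_sum_dominated)
    show "((\<lambda>j::int. c j N * p ^ nat (j ^ 2) * x powi j) has_sum
       (\<Prod>k<N. (1 + x * p * q ^ k) * (1 + p / x * q ^ k))) UNIV" for N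
      using finite_triple_product[OF p x, of N] by (simp add: c_def Q_def q_def)
    show "(\<lambda>N. c j N * p ^ nat (j ^ 2) * x powi j) \<longlonglongrightarrow> inverse E * p ^ nat (j ^ 2) * x powi j" for j
      by (intro tendsto_intros c_lim)
    show "norm (c j N * p ^ nat (j ^ 2) * x powi j)
        \<le> K1 * K2 * K2 * (norm p ^ nat (j ^ 2) * norm x powi j)" for j N
      using c_bound[of j N] by (simp add: norm_mult norm_power norm_power_int mult.assoc[of "cmod _"] mult_right_mono)
    show "(\<lambda>j. K1 * K2 * K2 * (norm p ^ nat (j ^ 2) * norm x powi j)) summable_on UNIV"
      by (intro summable_on_cmult_right theta_terms_summable) (use p x in auto)
    show "(\<lambda>N. \<Prod>k<N. (1 + x * p * q ^ k) * (1 + p / x * q ^ k)) \<longlonglongrightarrow>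
        qpochhammer_inf (- (x * p)) q * qpochhammer_inf (- (p / x)) q"
      using tendsto_mult[OF qpochhammer_tendsto[OF q, of "- (x * p)"] qpochhammer_tendsto[OF q, of "- (p / x)"]]
      by (simp add: prod.distrib)
  qed simp
  note scaled = has_sum_cmult_right[OF this, of E]
  have cancel: "E * (inverse E * u * v) = u * v" for u v
    using E by simp
  show ?thesis
    using scaled unfolding cancel by (simp only: E_def q_def)
qed

section \<open>Uniqueness of Laurent coefficients on the unit circle\<close>


lemma sum_powers_root_of_unity:
  fixes c :: complex
  assumes "c ^ M = 1"
  shows "(\<Sum>k<M. c ^ k) = (if c = 1 then of_nat M else 0)"
  using assms geometric_sum[of c M] by auto

lemma has_sum_finite_sum:
  fixes f :: "'k \<Rightarrow> 'i \<Rightarrow> 'c :: topological_comm_monoid_add"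
  assumes "finite K" "\<And>k. k \<in> K \<Longrightarrow> (f k has_sum S k) I"
  shows "((\<lambda>i. \<Sum>k\<in>K. f k i) has_sum (\<Sum>k\<in>K. S k)) I"
  using assms by (induction K rule: finite_induct) (auto intro!: has_sum_add)

lemma power_int_sum:
  fixes z :: "'a :: field"
  assumes "z \<noteq> 0"
  shows "z powi (\<Sum>i\<in>A. e i) = (\<Prod>i\<in>A. z powi e i)"
  using assms by (induction A rule: infinite_finite_induct) (auto simp: power_int_add)

text \<open>
  Averaging a series \<open>\<Sum> d\<^sub>N z^(N-m)\<close> over the \<open>M\<close>-th roots of unity \<open>z\<close> keeps exactly the terms with
  \<open>N \<equiv> m\<close> modulo \<open>M\<close>. If the series vanishes on the circle, so does every such sieved sum; as \<open>M\<close>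
  grows only \<open>d\<^sub>m\<close> is left. Absolute convergence, needed for the majorant, is automatic for
  unordered sums of complex numbers.
\<close>

lemma circle_coefficients_unique:
  fixes a b :: "int \<Rightarrow> complex"
  assumes a: "\<And>z. norm z = 1 \<Longrightarrow> ((\<lambda>N. a N * z powi N) has_sum S z) UNIV"
    and b: "\<And>z. norm z = 1 \<Longrightarrow> ((\<lambda>N. b N * z powi N) has_sum S z) UNIV"
  shows "a m = b m"
proof -
  define d where "d = (\<lambda>N. a N - b N)"
  have d: "((\<lambda>N. d N * z powi N) has_sum 0) UNIV" if "norm z = 1" for z
    using has_sum_add[OF a[OF that] has_sum_uminusI[OF b[OF that]]] by (simp add: d_def algebra_simps)
  have d_abs: "(\<lambda>N. norm (d N)) summable_on UNIV"
    using has_sum_imp_summable[OF d[of 1]] summable_on_iff_abs_summable_on_complex[of d UNIV] by simp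
  have sieve: "((\<lambda>N. d N * of_bool (int (Suc y) dvd N - m)) has_sum 0) UNIV" for y
  proof -
    define M where "M = Suc y"
    have M: "M > 0" by (simp add: M_def)
    define \<theta> where "\<theta> = 2 * of_real pi * \<i> / of_nat M"
    have w: "exp (of_int i * \<theta>) ^ k = exp (of_nat k * \<theta>) powi i" for i k
      by (simp add: exp_power_int exp_of_nat_mult[symmetric] mult_ac)
    have root: "exp (of_int i * \<theta>) ^ M = 1" for i
    proof -
      have "of_nat M * (of_int i * \<theta>) = 2 * of_int i * of_real pi * \<i>"
        using M by (simp add: \<theta>_def)
      then have "exp (of_int i * \<theta>) ^ M = exp (2 * of_int i * of_real pi * \<i>)"
        by (simp only: exp_of_nat_mult[symmetric])
      then show ?thesis by (simp add: exp_eq_1 mult_ac exI[of _ i])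
    qed
    have root_1: "exp (of_int i * \<theta>) = 1 \<longleftrightarrow> int M dvd i" for i
    proof -
      have "exp (of_int i * \<theta>) = 1 \<longleftrightarrow> (\<exists>n::int. real_of_int i * 2 * pi / M = of_int (2 * n) * pi)"
        unfolding exp_eq_1 by (simp add: \<theta>_def mult_ac)
      also have "\<dots> \<longleftrightarrow> (\<exists>n::int. real_of_int i = real_of_int (int M * n))"
        using M by (simp add: field_simps)
      also have "\<dots> \<longleftrightarrow> int M dvd i"
        unfolding of_int_eq_iff by (auto simp: dvd_def)
      finally show ?thesis .
    qed
    have "((\<lambda>N. \<Sum>k<M. exp (of_nat k * \<theta>) powi (- m) * (d N * exp (of_nat k * \<theta>) powi N))
        has_sum (\<Sum>k<M. exp (of_nat k * \<theta>) powi (- m) * 0)) UNIV"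
    proof (intro has_sum_finite_sum has_sum_cmult_right d finite_lessThan)
      show "norm (exp (of_nat k * \<theta>)) = 1" for k
        by (simp add: \<theta>_def)
    qed
    also have "(\<lambda>N. \<Sum>k<M. exp (of_nat k * \<theta>) powi (- m) * (d N * exp (of_nat k * \<theta>) powi N))
       = (\<lambda>N. of_nat M * (d N * of_bool (int M dvd N - m)))"
    proof
      fix N
      have "(\<Sum>k<M. exp (of_nat k * \<theta>) powi (- m) * (d N * exp (of_nat k * \<theta>) powi N))
          = d N * (\<Sum>k<M. exp (of_int (N - m) * \<theta>) ^ k)"
        unfolding w sum_distrib_left by (simp add: power_int_diff power_int_minus field_simps)
      also have "\<dots> = of_nat M * (d N * of_bool (int M dvd N - m))"
        using sum_powers_root_of_unity[OF root[of "N - m"]] root_1[of "N - m"] by simp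
      finally show "(\<Sum>k<M. exp (of_nat k * \<theta>) powi (- m) * (d N * exp (of_nat k * \<theta>) powi N))
        = of_nat M * (d N * of_bool (int M dvd N - m))" .
    qed
    finally have "((\<lambda>N. of_nat M * (d N * of_bool (int M dvd N - m))) has_sum 0) UNIV"
      by simp
    then show ?thesis
      unfolding M_def[symmetric] using M by (subst (asm) has_sum_cmult_right_iff) auto
  qed
  have "((\<lambda>N. d N * of_bool (N = m)) has_sum 0) UNIV"
  proof (rule tendsto_has_sum_dominated[OF _ _ d_abs sieve tendsto_const])
    show "(\<lambda>y. d N * of_bool (int (Suc y) dvd N - m)) \<longlonglongrightarrow> d N * of_bool (N = m)" for N
    proof (rule tendsto_eventually)
      show "\<forall>\<^sub>F y in sequentially. d N * of_bool (int (Suc y) dvd N - m) = d N * of_bool (N = m)"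
        unfolding eventually_sequentially
      proof (intro exI[of _ "nat \<bar>N - m\<bar>"] allI impI)
        fix y assume "nat \<bar>N - m\<bar> \<le> y"
        then have "\<bar>N - m\<bar> < int (Suc y)" by linarith
        then have "int (Suc y) dvd N - m \<longleftrightarrow> N = m"
          using dvd_imp_le_int[of "N - m" "int (Suc y)"] by fastforce
        then show "d N * of_bool (int (Suc y) dvd N - m) = d N * of_bool (N = m)" by simp
      qed
    qed
  qed auto
  moreover have "((\<lambda>N. d N * of_bool (N = m)) has_sum d m) UNIV"
    by (rule has_sum_finite_neutralI[where B = "{m}"]) auto
  ultimately have "d m = 0"
    by (rule has_sum_unique[symmetric])
  then show ?thesis by (simp add: d_def)
qed

section \<open>Products of Laurent series as sums over tuples\<close>


lemma abs_summable_prod_PiE: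
  fixes f :: "'a \<Rightarrow> 'b \<Rightarrow> complex"
  assumes "finite A" "\<And>x. x \<in> A \<Longrightarrow> (\<lambda>y. norm (f x y)) summable_on B x"
  shows "(\<lambda>g. norm (\<Prod>x\<in>A. f x (g x))) summable_on (PiE A B)"
  using assms
proof (induction A rule: finite_induct)
  case empty
  then show ?case by simp
next
  case (insert x F)
  define P where "P = (\<lambda>g. norm (\<Prod>x\<in>F. f x (g x)))"
  have inj: "inj_on (\<lambda>(y, g). g(x := y)) (B x \<times> PiE F B)"
    using insert.hyps by (intro inj_combinator) auto
  have P_upd: "norm (\<Prod>i\<in>insert x F. f i ((g(x := y)) i)) = norm (f x y) * P g" for y g
    using insert.hyps by (auto simp: P_def norm_mult intro!: prod.cong arg_cong[where f = norm])
  have "(\<lambda>(y, g). norm (f x y) * P g) summable_on (B x \<times> PiE F B)"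
  proof (rule summable_on_SigmaI)
    show "((\<lambda>g. case (y, g) of (y, g) \<Rightarrow> norm (f x y) * P g) has_sum
        (norm (f x y) * infsum P (PiE F B))) (PiE F B)" for y
      using insert.IH insert.prems by (auto simp: P_def intro!: has_sum_cmult_right has_sum_infsum)
    show "(\<lambda>y. norm (f x y) * infsum P (PiE F B)) summable_on B x"
      using insert.prems by (intro summable_on_cmult_left) auto
  qed (auto simp: P_def)
  moreover have "(\<lambda>g. norm (\<Prod>i\<in>insert x F. f i (g i))) \<circ> (\<lambda>(y, g). g(x := y))
      = (\<lambda>(y, g). norm (f x y) * P g)"
    by (rule ext) (simp only: o_def split_def P_upd)
  ultimately show ?case
    unfolding PiE_insert_eq by (simp only: summable_on_reindex[OF inj])
qed

text \<open>
  Multiplying out \<open>m\<close> Laurent series gives a sum over all integer tuples. The power of \<open>z\<close> attached to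
  a tuple is the sum of its entries, so grouping by that sum shows that the coefficient of \<open>z^N\<close> is
  the sum over the tuples with sum \<open>N\<close>.
\<close>

lemma has_sum_tuples_by_sum:
  fixes a :: "nat \<Rightarrow> int \<Rightarrow> complex"
  assumes a: "\<And>i. i \<in> {1..m} \<Longrightarrow> (\<lambda>j. norm (a i j)) summable_on UNIV"
  defines "t \<equiv> (\<lambda>s. \<Prod>i=1..m. a i (s i))"
  shows "t summable_on int_tuples_with_sum m N"
    and "norm z = 1 \<Longrightarrow> ((\<lambda>N. infsum t (int_tuples_with_sum m N) * z powi N) has_sum
       (\<Prod>i=1..m. \<Sum>\<^sub>\<infinity>j. a i j * z powi j)) UNIV"
proof -
  have "t summable_on (PiE {1..m} (\<lambda>_. UNIV))"
    unfolding t_def by (rule abs_summable_summable, rule abs_summable_prod_PiE) (auto intro: a)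
  then show t: "t summable_on int_tuples_with_sum m N" for N
    by (rule summable_on_subset) (auto simp: int_tuples_with_sum_def)
  assume z: "norm z = 1"
  then have z0: "z \<noteq> 0" by auto
  have az: "(\<lambda>j. norm (a i j * z powi j)) summable_on UNIV" if "i \<in> {1..m}" for i
    using a[OF that] by (simp add: norm_mult norm_power_int z)
  have "((\<lambda>s. \<Prod>i=1..m. a i (s i) * z powi s i) has_sum
      (\<Prod>i=1..m. \<Sum>\<^sub>\<infinity>j. a i j * z powi j)) (PiE {1..m} (\<lambda>_. UNIV))"
    unfolding has_sum_iff
  proof
    show "(\<lambda>s. \<Prod>i=1..m. a i (s i) * z powi s i) summable_on (PiE {1..m} (\<lambda>_. UNIV))"
      by (rule abs_summable_summable, rule abs_summable_prod_PiE) (auto intro: az)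
    show "(\<Sum>\<^sub>\<infinity>s\<in>PiE {1..m} (\<lambda>_. UNIV). \<Prod>i=1..m. a i (s i) * z powi s i)
        = (\<Prod>i=1..m. \<Sum>\<^sub>\<infinity>j. a i j * z powi j)"
      by (rule infsum_prod_PiE_abs) (auto intro: az)
  qed
  also have "(\<lambda>s. \<Prod>i=1..m. a i (s i) * z powi s i) = (\<lambda>s. t s * z powi (\<Sum>i=1..m. s i))"
    by (simp add: t_def prod.distrib power_int_sum z0)
  also have "((\<lambda>s. t s * z powi (\<Sum>i=1..m. s i)) has_sum
      (\<Prod>i=1..m. \<Sum>\<^sub>\<infinity>j. a i j * z powi j)) (PiE {1..m} (\<lambda>_. UNIV)) \<longleftrightarrow>
    ((\<lambda>(N, s). t s * z powi N) has_sum
      (\<Prod>i=1..m. \<Sum>\<^sub>\<infinity>j. a i j * z powi j)) (Sigma UNIV (int_tuples_with_sum m))"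
    by (rule has_sum_reindex_bij_witness[where j = "\<lambda>s. (\<Sum>i=1..m. s i, s)" and i = snd])
       (auto simp: int_tuples_with_sum_def PiE_iff extensional_def)
  finally show "((\<lambda>N. infsum t (int_tuples_with_sum m N) * z powi N) has_sum
       (\<Prod>i=1..m. \<Sum>\<^sub>\<infinity>j. a i j * z powi j)) UNIV"
    by (rule has_sum_SigmaD) (use t in \<open>auto intro!: has_sum_cmult_left has_sum_infsum\<close>)
qed

section \<open>Products of theta series twisted by the roots of -1\<close>

text \<open>
  The product of the \<open>m\<close> theta series at \<open>z \<omega>\<^sub>1, \<dots>, z \<omega>\<^sub>m\<close> has two expansions in \<open>z\<close> on the unit
  circle. Multiplied out, its coefficients are sums over integer tuples. Written as triple products,
  it collapses to \<open>(p\<^sup>2;p\<^sup>2)\<^sub>\<infinity>^m\<close> times two factors in \<open>z^m\<close> with nome \<open>p^m\<close>, which the triple product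
  for \<open>p^m\<close> expands again as a theta series in \<open>z^m\<close>. The claim compares the coefficients of
  \<open>z^(m j)\<close>.
\<close>

lemma theta_product_coefficient:
  fixes p :: complex and \<omega> :: "nat \<Rightarrow> complex"
  assumes p: "norm p < 1" and m: "m > 0"
    and unit: "\<And>i. i \<in> {1..m} \<Longrightarrow> norm (\<omega> i) = 1"
    and factor: "\<And>y. (\<Prod>i=1..m. 1 + y * \<omega> i) = 1 + y ^ m"
  defines "t \<equiv> (\<lambda>s. \<Prod>i=1..m. p ^ nat (s i ^ 2) * \<omega> i powi s i)"
  shows "t summable_on int_tuples_with_sum m N"
    and "qpochhammer_inf ((p ^ m) ^ 2) ((p ^ m) ^ 2) * infsum t (int_tuples_with_sum m (int m * j))
      = qpochhammer_inf (p ^ 2) (p ^ 2) ^ m * (p ^ m) ^ nat (j ^ 2)"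
proof -
  define Q where "Q = qpochhammer_inf (p ^ 2) (p ^ 2)"
  define P where "P = p ^ m"
  define R where "R = qpochhammer_inf (P ^ 2) (P ^ 2)"
  have P: "norm P < 1"
    using p m by (simp add: P_def norm_power power_less_one_iff)
  have p2: "norm (p ^ 2) < 1" and P2: "norm (P ^ 2) < 1"
    using p P by (simp_all add: norm_power power_less_one_iff)
  have P_sq: "(p ^ 2) ^ m = P ^ 2"
    by (simp add: P_def power_mult[symmetric] mult.commute)
  have R: "R \<noteq> 0"
    unfolding R_def by (rule qpochhammer_self_nonzero[OF P2])
  have abs: "(\<lambda>j. norm (p ^ nat (j ^ 2) * \<omega> i powi j)) summable_on UNIV" if "i \<in> {1..m}" for i
    using theta_terms_summable[of "norm p" 1] p unit[OF that]
    by (simp add: norm_mult norm_power norm_power_int)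
  show "t summable_on int_tuples_with_sum m N"
    unfolding t_def by (rule has_sum_tuples_by_sum(1)[OF abs])
  \<comment> \<open>The second theta factor contains \<open>1/\<omega>\<^sub>i\<close>, which is the conjugate of \<open>\<omega>\<^sub>i\<close>; the product formula
      for the inverses is thus the conjugate of the given one.\<close>
  have factor_inv: "(\<Prod>i=1..m. 1 + y * inverse (\<omega> i)) = 1 + y ^ m" for y
  proof -
    have "inverse (\<omega> i) = cnj (\<omega> i)" if "i \<in> {1..m}" for i
      using complex_div_cnj[of 1 "\<omega> i"] unit[OF that] by (simp add: divide_inverse)
    then have "(\<Prod>i=1..m. 1 + y * inverse (\<omega> i)) = cnj (\<Prod>i=1..m. 1 + cnj y * \<omega> i)"
      by simp
    also have "\<dots> = 1 + y ^ m"
      unfolding factor by simp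
    finally show ?thesis .
  qed
  define S where "S = (\<lambda>z. Q ^ m * (qpochhammer_inf (- (z ^ m * P)) (P ^ 2) * qpochhammer_inf (- (P / z ^ m)) (P ^ 2)))"
  define b where "b = (\<lambda>N. if int m dvd N then Q ^ m / R * P ^ nat ((N div int m) ^ 2) else 0)"
  have "infsum t (int_tuples_with_sum m (int m * j)) = b (int m * j)"
  proof (rule circle_coefficients_unique)
    fix z :: complex
    assume z: "norm z = 1"
    then have z0: "z \<noteq> 0" by auto
    have \<omega>0: "\<omega> i \<noteq> 0" if "i \<in> {1..m}" for i
      using unit[OF that] by auto
    have "(\<Sum>\<^sub>\<infinity>j. p ^ nat (j ^ 2) * \<omega> i powi j * z powi j)
        = Q * (qpochhammer_inf (- (z * p * \<omega> i)) (p ^ 2) * qpochhammer_inf (- (p / z * inverse (\<omega> i))) (p ^ 2))"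
      if "i \<in> {1..m}" for i
      using Jacobi_triple_product[OF p, of "z * \<omega> i", THEN infsumI] z0 \<omega>0[OF that]
      by (simp add: Q_def power_int_mult_distrib field_simps)
    then have "(\<Prod>i=1..m. \<Sum>\<^sub>\<infinity>j. p ^ nat (j ^ 2) * \<omega> i powi j * z powi j)
        = (\<Prod>i=1..m. Q * (qpochhammer_inf (- (z * p * \<omega> i)) (p ^ 2) * qpochhammer_inf (- (p / z * inverse (\<omega> i))) (p ^ 2)))"
      by (rule prod.cong[OF refl])
    also have "\<dots> = Q ^ m * (qpochhammer_inf (- ((z * p) ^ m)) (P ^ 2) * qpochhammer_inf (- ((p / z) ^ m)) (P ^ 2))"
      unfolding prod.distrib prod_qpochhammer[OF p2 factor]
        prod_qpochhammer[OF p2 factor_inv] P_sq by simp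
    also have "\<dots> = S z"
      by (simp add: S_def P_def power_mult_distrib power_divide)
    finally have expansion: "(\<Prod>i=1..m. \<Sum>\<^sub>\<infinity>j. p ^ nat (j ^ 2) * \<omega> i powi j * z powi j) = S z" .
    show "((\<lambda>N. infsum t (int_tuples_with_sum m N) * z powi N) has_sum S z) UNIV"
      unfolding t_def expansion[symmetric] by (rule has_sum_tuples_by_sum(2)[OF abs z])
    have "((\<lambda>j. Q ^ m / R * (P ^ nat (j ^ 2) * (z ^ m) powi j)) has_sum
        (Q ^ m / R * (R * (qpochhammer_inf (- (z ^ m * P)) (P ^ 2) * qpochhammer_inf (- (P / z ^ m)) (P ^ 2))))) UNIV"
      unfolding R_def using z0 by (intro has_sum_cmult_right Jacobi_triple_product P) auto
    also have "Q ^ m / R * (R * (qpochhammer_inf (- (z ^ m * P)) (P ^ 2) * qpochhammer_inf (- (P / z ^ m)) (P ^ 2))) = S z"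
      using R by (simp add: S_def)
    also have "(\<lambda>j. Q ^ m / R * (P ^ nat (j ^ 2) * (z ^ m) powi j)) = (\<lambda>N. b N * z powi N) \<circ> (\<lambda>j. int m * j)"
      using m by (auto simp: fun_eq_iff b_def power_int_power)
    also have "(\<dots> has_sum S z) UNIV \<longleftrightarrow> ((\<lambda>N. b N * z powi N) has_sum S z) (range (\<lambda>j. int m * j))"
      using m by (intro has_sum_reindex[symmetric]) (auto simp: inj_on_def)
    also have "\<dots> \<longleftrightarrow> ((\<lambda>N. b N * z powi N) has_sum S z) UNIV"
      by (rule has_sum_cong_neutral) (auto simp: b_def dvd_def)
    finally show "((\<lambda>N. b N * z powi N) has_sum S z) UNIV" .
  qed
  then show "qpochhammer_inf ((p ^ m) ^ 2) ((p ^ m) ^ 2) * infsum t (int_tuples_with_sum m (int m * j))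
      = qpochhammer_inf (p ^ 2) (p ^ 2) ^ m * (p ^ m) ^ nat (j ^ 2)"
    using R m by (simp add: b_def R_def P_def Q_def)
qed

text \<open>
  For even \<open>m\<close> both sides are polynomials in \<open>y\<close> of degree at most \<open>m\<close> that vanish at the \<open>m\<close> points
  \<open>-1/\<omega>\<^sub>i\<close> and take the value 1 at 0, hence agree at \<open>m + 1\<close> points.
\<close>

lemma prod_one_plus_eq_one_plus_power:
  fixes \<omega> :: "'i \<Rightarrow> 'a :: field"
  assumes "finite A" "inj_on \<omega> A" and "card A = m" and "m > 0"
    and root: "\<And>i. i \<in> A \<Longrightarrow> \<omega> i ^ m = - 1" and m: "even m"
  shows "(\<Prod>i\<in>A. 1 + y * \<omega> i) = 1 + y ^ m"
proof -
  define f where "f = (\<Prod>i\<in>A. [:1, \<omega> i:])"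
  define g where "g = (1 + monom 1 m :: 'a poly)"
  define Z where "Z = insert 0 ((\<lambda>i. - inverse (\<omega> i)) ` A)"
  have nz: "\<omega> i \<noteq> 0" if "i \<in> A" for i
    using root[OF that] \<open>m > 0\<close> by (auto simp: power_0_left)
  have "inj_on (\<lambda>i. - inverse (\<omega> i)) A"
    using \<open>inj_on \<omega> A\<close> by (auto simp: inj_on_def)
  then have Z: "card Z = Suc m"
    using assms(1,3) nz by (auto simp: Z_def card_image card_insert_if)
  have "f = g"
  proof (rule poly_eqI_degree)
    show "poly f x = poly g x" if "x \<in> Z" for x
    proof (cases "x = 0")
      case True
      then show ?thesis
        using \<open>m > 0\<close> by (simp add: f_def g_def poly_prod poly_monom)
    next
      case False
      with that obtain i where i: "i \<in> A" "x = - inverse (\<omega> i)"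
        by (auto simp: Z_def)
      have "poly f x = 0"
        using i nz[OF i(1)] assms(1) by (auto simp: f_def poly_prod intro!: bexI[of _ i])
      moreover have "poly g x = 0"
        using i root[OF i(1)] m by (simp add: g_def poly_monom power_inverse)
      ultimately show ?thesis by simp
    qed
    have "degree f \<le> (\<Sum>i\<in>A. degree [:1, \<omega> i:])"
      unfolding f_def using degree_prod_sum_le[OF assms(1), of "\<lambda>i. [:1, \<omega> i:]"] by (simp add: o_def)
    also have "\<dots> \<le> m"
      using sum_bounded_above[of A "\<lambda>i. degree [:1, \<omega> i:]" 1] assms(3) by simp
    finally show "degree f < card Z"
      using Z by simp
    have "degree g \<le> m"
      unfolding g_def by (intro degree_add_le) (auto simp: degree_monom_le)
    then show "degree g < card Z"
      using Z by simp
  qed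
  then have "poly f y = poly g y" by simp
  then show ?thesis
    by (simp add: f_def g_def poly_prod poly_monom)
qed

section \<open>The 2n-th power of the Euler product\<close>


theorem corollary1p10:
  fixes \<tau> q :: complex and n :: nat and f :: "(nat \<Rightarrow> int) \<Rightarrow> complex"
  assumes "Im \<tau> > 0"
    and "q = exp (2 * complex_of_real pi * \<i> * \<tau>)"
    and "n \<ge> 1"
  defines "f \<equiv> (\<lambda>s. qpow \<tau> ((\<Sum>i=1..2*n. real_of_int (s i) ^ 2) / 2) *
        exp (complex_of_real pi * \<i> / of_nat (2 * n) *
             of_int (\<Sum>l=1..n. (s l - s (n + l)) * (2 * int l - 1))))"
  shows "f summable_on int_tuples_with_sum (2 * n) (2 * int n) \<and>
    qpochhammer_inf q q ^ (2 * n) =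
      qpow \<tau> (- real n) * qpochhammer_inf (q ^ (2 * n)) (q ^ (2 * n)) *
      (\<Sum>\<^sub>\<infinity>s \<in> int_tuples_with_sum (2 * n) (2 * int n). f s)"
proof -
  \<comment> \<open>\<open>p\<close> is the square root of \<open>q\<close> singled out by \<open>\<tau>\<close>. As \<open>i\<close> runs through \<open>1, \<dots>, 2n\<close>, \<open>e i\<close> runs
      through the odd integers between \<open>-2n\<close> and \<open>2n\<close>, so the \<open>\<omega> i\<close> are the \<open>2n\<close>-th roots of \<open>-1\<close>.\<close>
  define p where "p = exp (complex_of_real pi * \<i> * \<tau>)"
  define e where "e = (\<lambda>i. if i \<le> n then 2 * int i - 1 else - (2 * int (i - n) - 1))"
  define \<omega> where "\<omega> = (\<lambda>i. exp (complex_of_real pi * \<i> / of_nat (2 * n) * of_int (e i)))"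
  define t where "t = (\<lambda>s. \<Prod>i=1..2*n. p ^ nat (s i ^ 2) * \<omega> i powi s i)"
  have n: "n > 0" using \<open>n \<ge> 1\<close> by simp
  have q_eq: "q = p ^ 2"
    unfolding p_def assms(2) exp_of_nat_mult[symmetric] by (simp add: mult_ac)
  have p: "norm p < 1"
    using \<open>Im \<tau> > 0\<close> by (simp add: p_def)
  have unit: "norm (\<omega> i) = 1" for i
    by (simp add: \<omega>_def)
  have e_odd: "odd (e i)" for i
    by (simp add: e_def)
  have e_bound: "\<bar>e i\<bar> < 2 * int n" if "i \<in> {1..2*n}" for i
    using that by (auto simp: e_def)
  have e_inj: "inj_on e {1..2*n}"
    by (auto simp: inj_on_def e_def split: if_splits)
  have root: "\<omega> i ^ (2 * n) = - 1" for i
  proof -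
    obtain k where k: "e i = 2 * k + 1"
      using e_odd[of i] by (elim oddE)
    have "of_nat (2 * n) * (complex_of_real pi * \<i> / of_nat (2 * n) * of_int (e i))
        = 2 * of_int k * of_real pi * \<i> + of_real pi * \<i>"
      using n by (simp add: k field_simps)
    then have "\<omega> i ^ (2 * n) = exp (2 * of_int k * of_real pi * \<i> + of_real pi * \<i>)"
      unfolding \<omega>_def by (simp only: exp_of_nat_mult[symmetric])
    also have "\<dots> = exp (2 * of_int k * of_real pi * \<i>) * exp (of_real pi * \<i>)"
      by (rule exp_add)
    also have "exp (2 * of_int k * of_real pi * \<i>) = 1"
      by (simp add: exp_eq_1 mult_ac exI[of _ k])
    finally show ?thesis by simp
  qed
  have "inj_on \<omega> {1..2*n}"
  proof (rule inj_onI)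
    fix i j assume ij: "i \<in> {1..2*n}" "j \<in> {1..2*n}" "\<omega> i = \<omega> j"
    let ?x = "\<lambda>i. complex_of_real pi * \<i> / of_nat (2 * n) * of_int (e i)"
    have Im: "Im (?x i) = real_of_int (e i) * (pi / (2 * n))" for i
      by simp
    have "\<bar>real_of_int (e i) - real_of_int (e j)\<bar> < 4 * real n"
      using e_bound[OF ij(1)] e_bound[OF ij(2)] by linarith
    then have "\<bar>real_of_int (e i) - real_of_int (e j)\<bar> * (pi / (2 * n)) < 4 * real n * (pi / (2 * n))"
      using n by (intro mult_strict_right_mono) auto
    then have "\<bar>Im (?x i) - Im (?x j)\<bar> < 2 * pi"
      unfolding Im left_diff_distrib[symmetric] abs_mult using n by simp
    then have "?x i = ?x j"
      by (rule exp_complex_eqI) (use ij in \<open>simp add: \<omega>_def\<close>)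
    then have "e i = e j"
      using n by simp
    then show "i = j"
      using e_inj ij by (auto dest: inj_onD)
  qed
  then have factor: "(\<Prod>i=1..2*n. 1 + y * \<omega> i) = 1 + y ^ (2 * n)" for y
    by (intro prod_one_plus_eq_one_plus_power root) (use n in auto)
  have f_eq: "f = t"
  proof
    fix s
    have pow: "p ^ nat (k ^ 2) = exp (complex_of_real pi * \<i> * \<tau> * of_int k ^ 2)" for k :: int
    proof -
      have "p ^ nat (k ^ 2) = exp (of_nat (nat (k ^ 2)) * (complex_of_real pi * \<i> * \<tau>))"
        unfolding p_def exp_of_nat_mult ..
      also have "(of_nat (nat (k ^ 2)) :: complex) = of_int k ^ 2"
        by (metis of_int_of_nat_eq of_int_power zero_le_power2 int_nat_eq)
      finally show ?thesis by (simp add: mult_ac)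
    qed
    have "qpow \<tau> ((\<Sum>i=1..2*n. real_of_int (s i) ^ 2) / 2)
        = exp (\<Sum>i=1..2*n. complex_of_real pi * \<i> * \<tau> * of_int (s i) ^ 2)"
      unfolding qpow_def sum_distrib_left[symmetric] by (simp add: mult_ac)
    also have "\<dots> = (\<Prod>i=1..2*n. p ^ nat (s i ^ 2))"
      by (simp add: exp_sum pow)
    finally have 1: "qpow \<tau> ((\<Sum>i=1..2*n. real_of_int (s i) ^ 2) / 2) = (\<Prod>i=1..2*n. p ^ nat (s i ^ 2))" .
    have "(\<Sum>i=1..2*n. s i * e i) = (\<Sum>i=1..n. s i * e i) + (\<Sum>i=n+1..2*n. s i * e i)"
      using sum.ub_add_nat[of 1 n "\<lambda>i. s i * e i" n] by (simp add: mult_2)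
    also have "(\<Sum>i=n+1..2*n. s i * e i) = (\<Sum>l=1..n. s (n + l) * e (n + l))"
      using sum.shift_bounds_cl_nat_ivl[of "\<lambda>i. s i * e i" 1 n n] by (simp add: mult_2 add.commute)
    also have "(\<Sum>i=1..n. s i * e i) + (\<Sum>l=1..n. s (n + l) * e (n + l))
        = (\<Sum>l=1..n. (s l - s (n + l)) * (2 * int l - 1))"
      unfolding sum.distrib[symmetric] by (intro sum.cong) (auto simp: e_def algebra_simps)
    finally have "(\<Sum>l=1..n. (s l - s (n + l)) * (2 * int l - 1)) = (\<Sum>i=1..2*n. s i * e i)" ..
    then have "exp (complex_of_real pi * \<i> / of_nat (2 * n) * of_int (\<Sum>l=1..n. (s l - s (n + l)) * (2 * int l - 1)))
        = exp (\<Sum>i=1..2*n. of_int (s i) * (complex_of_real pi * \<i> / of_nat (2 * n) * of_int (e i)))"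
      by (simp only: of_int_sum of_int_mult sum_distrib_left mult_ac)
    also have "\<dots> = (\<Prod>i=1..2*n. \<omega> i powi s i)"
      by (simp only: exp_sum finite_atLeastAtMost \<omega>_def exp_power_int)
    finally show "f s = t s"
      unfolding f_def 1 t_def prod.distrib by simp
  qed
  have N: "2 * int n = int (2 * n) * 1" by simp
  have sq: "(p ^ (2 * n)) ^ 2 = q ^ (2 * n)"
    unfolding q_eq power_mult[symmetric] by (simp add: mult_ac)
  have "f summable_on int_tuples_with_sum (2 * n) (2 * int n)"
    unfolding f_eq t_def by (rule theta_product_coefficient(1)[OF p _ unit factor]) (use n in auto)
  moreover have "qpochhammer_inf q q ^ (2 * n) = qpow \<tau> (- real n) *
      qpochhammer_inf (q ^ (2 * n)) (q ^ (2 * n)) * infsum f (int_tuples_with_sum (2 * n) (2 * int n))"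
  proof -
    have coeff: "qpochhammer_inf (q ^ (2 * n)) (q ^ (2 * n)) * infsum f (int_tuples_with_sum (2 * n) (2 * int n))
        = qpochhammer_inf q q ^ (2 * n) * p ^ (2 * n)"
      using theta_product_coefficient(2)[OF p _ unit factor, of 1] n
      unfolding f_eq N t_def sq q_eq[symmetric] by simp
    have "p ^ (2 * n) = exp (of_nat (2 * n) * (complex_of_real pi * \<i> * \<tau>))"
      unfolding p_def exp_of_nat_mult ..
    then have "p ^ (2 * n) * qpow \<tau> (- real n) = 1"
      by (simp add: qpow_def exp_add[symmetric])
    then have "qpochhammer_inf q q ^ (2 * n) = qpow \<tau> (- real n) * (qpochhammer_inf q q ^ (2 * n) * p ^ (2 * n))"
      by (simp add: mult_ac)
    then show ?thesis
      unfolding coeff[symmetric] mult.assoc .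
  qed
  ultimately show ?thesis ..
qed

end
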